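(* Let $(M,\mathcal{M},\mu)$ be an arbitrary $\sigma$-finite measure space, and let $\mathfrak{Z}$ be an $\mathbb{F}$-Fréchet space. Consider a sequence of functions $\psi_k:M\to\mathfrak{Z}'$, $k\in\mathbb{N}$, and $\psi:M\to\mathfrak{Z}'$ such that (i) for any $z\in\mathfrak{Z}$ and $k\in\mathbb{N}$ the function $x\mapsto\langle\psi_k(x),z\rangle$ is $\mu$-measurable; (ii) for any $z\in\mathfrak{Z}$ the function $x\mapsto\langle\psi(x),z\rangle$ is $\mu$-measurable; (iii) for $\mu$-a.e. $x\in M$, $\psi_k(x)\to\psi(x)$ in $(\mathfrak{Z}',\sigma(\mathfrak{Z}',\mathfrak{Z}))$ as $k\to\infty$; (iv) for any $z\in\mathfrak{Z}$ there exist $0\leq g^z\in L^1(\mu)$ and $N_z\in\mathcal{M}$ with $\mu(N_z)=0$ and $|\langle\psi_k(x),z\rangle|\leq g^z(x)$ for $x\notin N_z$ and $k\in\mathbb{N}$. Then $\psi$ is $\mathfrak{Z}'$-Gelfand $\mu$-integrable, and as $k\to\infty$ $$\int_M\psi_k(x)\,\mu(dx)\to\int_M\psi(x)\,\mu(dx)\quad\text{in }(\mathfrak{Z}',\sigma(\mathfrak{Z}',\mathfrak{Z})).$$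
   Context: $\mathbb{F}\in\{\mathbb{R},\mathbb{C}\}$. A Fréchet space is a metrizable, complete, locally convex topological vector space over $\mathbb{F}$; $\mathfrak{Z}'$ is its topological dual and $\langle z',z\rangle$ the dual pairing of $z'\in\mathfrak{Z}'$, $z\in\mathfrak{Z}$. $\sigma(\mathfrak{Z}',\mathfrak{Z})$ is the weak star topology on $\mathfrak{Z}'$, i.e. the coarsest topology making all maps $z'\mapsto\langle z',z\rangle$, $z\in\mathfrak{Z}$, continuous. A map $\psi:M\to\mathfrak{Z}'$ is $\mathfrak{Z}'$-Gelfand $\mu$-integrable if $x\mapsto\langle\psi(x),z\rangle$ belongs to $L^1(\mu)$ for every $z\in\mathfrak{Z}$. For such $\psi$ and $E\in\mathcal{M}$, the Gelfand integral $\int_E\psi(x)\,\mu(dx)$ is the element of $\mathfrak{Z}'$ given by $z\mapsto\int_E\langle\psi(x),z\rangle\,\mu(dx)$ (this functional is continuous). *)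

theory Defs
  imports "HOL-Analysis.Analysis"
begin

(* The scalar fields real and complex. A norm on such a field that is multiplicative and extends
   the absolute value on the reals is the usual one, so up to isometric isomorphism there are no
   other members. *)
class real_or_complex = real_normed_field + banach + second_countable_topology +
  assumes real_or_complex:
    "(\<forall>x. \<exists>a. x = a *\<^sub>R 1) \<or>
     (\<exists>i. i * i = - 1 \<and> (\<forall>x. \<exists>a b. x = a *\<^sub>R 1 + b *\<^sub>R i))"

instance real :: real_or_complex
  by standard simp

instance complex :: real_or_complex
proof
  have "\<exists>a b. x = a *\<^sub>R 1 + b *\<^sub>R \<i>" for x :: complex
    by (intro exI[of _ "Re x"] exI[of _ "Im x"]) (simp add: complex_eq_iff)
  then show "(\<forall>x::complex. \<exists>a. x = a *\<^sub>R 1) \<or>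
     (\<exists>i::complex. i * i = - 1 \<and> (\<forall>x. \<exists>a b. x = a *\<^sub>R 1 + b *\<^sub>R i))"
    using i_squared by blast
qed

(* The scalar multiplication is an explicit parameter, since the scalars vary over two fields.
   The uniformity of a uniform_topological_group_add is the one induced by the group topology
   (see cauchy_seq_finset_iff_vanishing), so complete is completeness as a topological
   vector space, i.e. convergence of all Cauchy filters. *)
locale frechet_space = vector_space smul
  for smul :: "'f::real_or_complex \<Rightarrow> 'z::{uniform_topological_group_add, ab_group_add} \<Rightarrow> 'z" +
  assumes continuous_scale: "continuous_on UNIV (\<lambda>(a, x). smul a x)"
    and metrizable: "metrizable_space (euclidean :: 'z topology)"
    and complete_UNIV: "complete (UNIV :: 'z set)"
    and locally_convex: "\<And>U. open U \<Longrightarrow> 0 \<in> U \<Longrightarrow>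
      \<exists>V. open V \<and> 0 \<in> V \<and> V \<subseteq> U \<and>
        (\<forall>x\<in>V. \<forall>y\<in>V. \<forall>t\<in>{0..1::real}.
           smul (of_real (1 - t)) x + smul (of_real t) y \<in> V)"

(* Functionals are plain functions, so the dual pairing of f and z is the application f z. *)
definition top_dual ::
  "('f::real_or_complex \<Rightarrow> 'z::{topological_space, ab_group_add} \<Rightarrow> 'z) \<Rightarrow> ('z \<Rightarrow> 'f) set" where
  "top_dual smul = {f. Vector_Spaces.linear smul (*) f \<and> continuous_on UNIV f}"

definition weak_star ::
  "('f::real_or_complex \<Rightarrow> 'z::{topological_space, ab_group_add} \<Rightarrow> 'z) \<Rightarrow> ('z \<Rightarrow> 'f) topology" where
  "weak_star smul =
     topology_generated_by {{f \<in> top_dual smul. f z \<in> U} | z U. open U}"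

definition gelfand_integrable ::
  "('f::real_or_complex \<Rightarrow> 'z::{topological_space, ab_group_add} \<Rightarrow> 'z) \<Rightarrow> 'm measure \<Rightarrow>
     ('m \<Rightarrow> 'z \<Rightarrow> 'f) \<Rightarrow> bool" where
  "gelfand_integrable smul M \<psi> \<longleftrightarrow>
     \<psi> \<in> space M \<rightarrow> top_dual smul \<and> (\<forall>z. integrable M (\<lambda>x. \<psi> x z))"

definition gelfand_integral ::
  "'m measure \<Rightarrow> 'm set \<Rightarrow> ('m \<Rightarrow> 'z \<Rightarrow> 'f::real_or_complex) \<Rightarrow> 'z \<Rightarrow> 'f" where
  "gelfand_integral M E \<psi> = (\<lambda>z. LINT x:E|M. \<psi> x z)"

end

theory Submission
  imports Defs
begin

text \<open>
  Along each fixed \<open>z\<close> the statement is dominated convergence for scalar functions. What this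
  leaves open is that \<open>z \<mapsto> \<integral> \<langle>\<phi>(x), z\<rangle> d\<mu>\<close> is a continuous functional whenever \<open>\<phi>\<close> is Gelfand
  integrable, so that the integrals are points of the space carrying the weak star topology
  (lemma \<open>gelfand_integral_in_top_dual\<close>).

  For this, consider the seminorm \<open>p z = \<integral> |\<langle>\<phi>(x), z\<rangle>| d\<mu>\<close>, which is finite everywhere. Since
  every \<open>\<phi>(x)\<close> is continuous, Fatou's lemma makes the sublevel sets of \<open>p\<close> sequentially closed,
  hence closed by metrizability (\<open>closed_sublevel_integral_norm\<close>). A category argument in the
  complete space then shows that \<open>p\<close> is bounded near \<open>0\<close> (\<open>subadditive_closed_sublevel_bounded\<close>).
  As the modulus of the integral is at most \<open>p z\<close>, the integral is a linear functional bounded on a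
  neighbourhood of \<open>0\<close>, and thus continuous. Weak star convergence is pointwise convergence
  in the dual (\<open>limitin_weak_star_iff\<close>), which reduces the rest to dominated convergence.
\<close>

section \<open>The weak star topology\<close>

lemma topspace_weak_star: "topspace (weak_star smul) = top_dual smul"
proof -
  have "top_dual smul \<in> {{f \<in> top_dual smul. f z \<in> U} | z U. open U}"
    by (rule CollectI, rule exI[of _ 0], rule exI[of _ UNIV]) auto
  then show ?thesis
    unfolding weak_star_def topology_generated_by_topspace by blast
qed

lemma limitin_topology_generated_by:
  assumes "l \<in> \<Union>S"
    and "\<And>U. U \<in> S \<Longrightarrow> l \<in> U \<Longrightarrow> \<forall>\<^sub>F x in F. f x \<in> U"
  shows "limitin (topology_generated_by S) f l F"
  unfolding limitin_def
proof (intro conjI allI impI)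
  show "l \<in> topspace (topology_generated_by S)"
    using assms(1) by simp
next
  fix U assume U: "openin (topology_generated_by S) U \<and> l \<in> U"
  then have "generate_topology_on S U"
    using openin_topology_generated_by by blast
  then have "l \<in> U \<longrightarrow> (\<forall>\<^sub>F x in F. f x \<in> U)"
  proof induct
    case (Int a b)
    then show ?case by (auto simp: eventually_conj_iff)
  next
    case (UN K)
    show ?case
    proof
      assume "l \<in> \<Union>K"
      then obtain A where A: "A \<in> K" "l \<in> A" by blast
      with UN have "\<forall>\<^sub>F x in F. f x \<in> A" by blast
      then show "\<forall>\<^sub>F x in F. f x \<in> \<Union>K"
        by (rule eventually_mono) (use A(1) in blast)
    qed
  qed (use assms(2) in auto)
  then show "\<forall>\<^sub>F x in F. f x \<in> U"
    using U by blast
qed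

lemma limitin_weak_star_iff:
  assumes "\<And>k. f k \<in> top_dual smul"
  shows "limitin (weak_star smul) f l F \<longleftrightarrow>
    l \<in> top_dual smul \<and> (\<forall>z. ((\<lambda>k. f k z) \<longlongrightarrow> l z) F)"
proof safe
  assume lim: "limitin (weak_star smul) f l F"
  then show l: "l \<in> top_dual smul"
    by (metis limitin_topspace topspace_weak_star)
  fix z
  show "((\<lambda>k. f k z) \<longlongrightarrow> l z) F"
  proof (rule topological_tendstoI)
    fix U assume U: "open U" "l z \<in> U"
    have "openin (weak_star smul) {g \<in> top_dual smul. g z \<in> U}"
      unfolding weak_star_def by (rule topology_generated_by_Basis) (use U in blast)
    then have "\<forall>\<^sub>F k in F. f k \<in> {g \<in> top_dual smul. g z \<in> U}"
      using lim l U unfolding limitin_def by blast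
    then show "\<forall>\<^sub>F k in F. f k z \<in> U"
      by (rule eventually_mono) simp
  qed
next
  assume l: "l \<in> top_dual smul" and lim: "\<forall>z. ((\<lambda>k. f k z) \<longlongrightarrow> l z) F"
  show "limitin (weak_star smul) f l F"
    unfolding weak_star_def
  proof (rule limitin_topology_generated_by)
    show "l \<in> \<Union>{{f \<in> top_dual smul. f z \<in> U} | z U. open U}"
      using l topspace_weak_star[of smul] unfolding weak_star_def by simp
  next
    fix B assume "B \<in> {{f \<in> top_dual smul. f z \<in> U} | z U. open U}" "l \<in> B"
    then obtain z U where B: "B = {f \<in> top_dual smul. f z \<in> U}" and U: "open U" "l z \<in> U"
      by blast
    have "\<forall>\<^sub>F k in F. f k z \<in> U"
      using lim U topological_tendstoD by blast
    then show "\<forall>\<^sub>F k in F. f k \<in> B"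
      using B assms by simp
  qed
qed

section \<open>Subadditive functions on complete topological groups\<close>

lemma open_diff_nhd:
  fixes V :: "'z::topological_group_add set"
  assumes "open V" "0 \<in> V"
  obtains W where "open W" "0 \<in> W" "\<And>a b. a \<in> W \<Longrightarrow> b \<in> W \<Longrightarrow> a - b \<in> V"
proof -
  have "open ((\<lambda>x::'z \<times> 'z. fst x - snd x) -` V)"
    by (intro open_vimage assms continuous_intros)
  moreover have "(0, 0) \<in> (\<lambda>x::'z \<times> 'z. fst x - snd x) -` V"
    using assms by simp
  ultimately obtain A B where "open A" "open B" "(0, 0) \<in> A \<times> B"
      and "A \<times> B \<subseteq> (\<lambda>x::'z \<times> 'z. fst x - snd x) -` V"
    by (rule open_prod_elim)
  then show ?thesis
    by (intro that[of "A \<inter> B"]) auto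
qed

lemma complete_group_Cauchy_convergent:
  fixes s :: "nat \<Rightarrow> 'z::uniform_topological_group_add"
  assumes "complete (UNIV :: 'z set)"
    and "\<And>U. open U \<Longrightarrow> 0 \<in> U \<Longrightarrow> \<exists>N. \<forall>m\<ge>N. \<forall>n\<ge>N. s m - s n \<in> U"
  obtains l where "s \<longlonglongrightarrow> l"
proof -
  have "Cauchy s"
    unfolding Cauchy_uniform_iff
  proof (intro allI impI)
    fix P :: "'z \<times> 'z \<Rightarrow> bool" assume "eventually P uniformity"
    then obtain Q where Q: "eventually Q (nhds 0)" "\<And>x y. Q (y - x) \<Longrightarrow> P (x, y)"
      unfolding cauchy_seq_finset_iff_vanishing eventually_filtercomap by auto
    then obtain U where "open U" "0 \<in> U" "\<And>u. u \<in> U \<Longrightarrow> Q u"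
      unfolding eventually_nhds by blast
    then show "\<exists>N. \<forall>n\<ge>N. \<forall>m\<ge>N. P (s n, s m)"
      using assms(2)[of U] Q(2) by meson
  qed
  then have "cauchy_filter (filtermap s sequentially)"
    by (simp add: Cauchy_uniform)
  then obtain l where "filtermap s sequentially \<le> nhds l"
    using cauchy_filter_complete_converges[OF _ assms(1)]
    by (metis filtermap_bot_iff principal_UNIV sequentially_bot top_greatest)
  then show ?thesis
    using that by (simp add: filterlim_def)
qed

text \<open>
  A form of the uniform boundedness principle. If \<open>p\<close> were unbounded on every neighbourhood of \<open>0\<close>,
  then inside any translate \<open>s + V\<close> there would be points where \<open>p\<close> is as large as desired, and,
  the sublevel sets being closed, whole neighbourhoods of such points. Iterating yields a shrinking
  nested sequence of sets \<open>s\<^sub>n + V\<^sub>n\<close> on which \<open>p > n\<close>; by completeness the \<open>s\<^sub>n\<close> converge,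
  to a point common to all these sets, where \<open>p\<close> cannot have a finite value.
\<close>
lemma subadditive_closed_sublevel_bounded:
  fixes p :: "'z::{uniform_topological_group_add, ab_group_add} \<Rightarrow> real"
  assumes compl: "complete (UNIV :: 'z set)"
    and base: "\<And>n::nat. open (U n :: 'z set)" "\<And>n. 0 \<in> U n"
      "\<And>V. open V \<Longrightarrow> 0 \<in> V \<Longrightarrow> \<exists>n. U n \<subseteq> V"
    and subadd: "\<And>x y. p (x + y) \<le> p x + p y"
    and closed: "\<And>c. closed {z. p z \<le> c}"
  shows "\<exists>V C. open V \<and> 0 \<in> V \<and> (\<forall>v\<in>V. p v \<le> C)"
proof (rule ccontr)
  assume neg: "\<not> ?thesis"
  then have unbdd: "\<exists>v\<in>V. C < p v" if "open V" "0 \<in> V" for V C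
    using neg that by (meson not_le)
  have superlevel: "open {z. c < p z}" for c
  proof -
    have "{z. c < p z} = - {z. p z \<le> c}" by auto
    then show ?thesis using closed by (simp add: open_closed)
  qed
  define P where "P = (\<lambda>(n::nat) (s, V). open V \<and> (0::'z) \<in> V \<and> (\<forall>v\<in>V. real n < p (s + v)))"
  \<comment> \<open>The set \<open>W\<close> makes sure that even the closure of \<open>s' + V'\<close> lies in \<open>s + V\<close>.\<close>
  define Q where "Q = (\<lambda>n (s, V) (s', V'). (\<forall>a\<in>V'. \<forall>b\<in>V'. a - b \<in> U n) \<and>
    (\<exists>W. open W \<and> (0::'z) \<in> W \<and> (\<forall>v\<in>V'. \<forall>w\<in>W. s' - s + v - w \<in> V)))"
  have shift: "open ((\<lambda>v. s + v) -` {y. c < p y})" for s c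
    by (intro open_vimage superlevel continuous_intros)
  have "\<exists>f. \<forall>n. P n (f n) \<and> Q n (f n) (f (Suc n))"
  proof (rule dependent_nat_choice)
    obtain s where "0 < p s" using unbdd[of UNIV 0] by auto
    then have "P 0 (s, (\<lambda>v. s + v) -` {y. 0 < p y})"
      using shift by (simp add: P_def)
    then show "\<exists>x. P 0 x" ..
  next
    fix x n assume "P n x"
    then obtain s V where x: "x = (s, V)" and V: "open V" "0 \<in> V"
      by (cases x) (auto simp: P_def)
    obtain W0 where W0: "open W0" "0 \<in> W0" "\<And>a b. a \<in> W0 \<Longrightarrow> b \<in> W0 \<Longrightarrow> a - b \<in> V"
      using open_diff_nhd[OF V] by blast
    obtain W1 where W1: "open W1" "0 \<in> W1" "\<And>a b. a \<in> W1 \<Longrightarrow> b \<in> W1 \<Longrightarrow> a - b \<in> W0"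
      using open_diff_nhd[OF W0(1,2)] by blast
    obtain W2 where W2: "open W2" "0 \<in> W2" "\<And>a b. a \<in> W2 \<Longrightarrow> b \<in> W2 \<Longrightarrow> a - b \<in> U n"
      using open_diff_nhd[OF base(1,2)] by blast
    have sum3: "a + b - c \<in> V" if "a \<in> W1" "b \<in> W1" "c \<in> W1" for a b c
    proof -
      have "a \<in> W0" using W1(3)[OF that(1) W1(2)] by simp
      moreover have "c - b \<in> W0" using W1(3) that by blast
      ultimately have "a - (c - b) \<in> V" by (rule W0(3))
      then show ?thesis by (simp add: algebra_simps)
    qed
    obtain z where z: "z \<in> W1" "real (Suc n) + p (- s) < p z"
      using unbdd[OF W1(1,2)] by blast
    have "p z \<le> p (s + z) + p (- s)"
      using subadd[of "s + z" "- s"] by simp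
    with z have big: "real (Suc n) < p (s + z)" by simp
    define V' where "V' = W1 \<inter> W2 \<inter> (\<lambda>v. (s + z) + v) -` {y. real (Suc n) < p y}"
    have "open V'"
      unfolding V'_def by (intro open_Int W1 W2 shift)
    then have "P (Suc n) (s + z, V')"
      using W1 W2 big by (auto simp: P_def V'_def)
    moreover have "Q n x (s + z, V')"
    proof -
      have "\<forall>v\<in>V'. \<forall>w\<in>W1. (s + z) - s + v - w \<in> V"
        using sum3 z(1) by (auto simp: V'_def)
      moreover have "\<forall>a\<in>V'. \<forall>b\<in>V'. a - b \<in> U n"
        using W2(3) by (auto simp: V'_def)
      ultimately show ?thesis
        unfolding Q_def x using W1(1,2) by auto
    qed
    ultimately show "\<exists>y. P (Suc n) y \<and> Q n x y" by blast
  qed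
  then obtain f where f: "\<And>n. P n (f n)" "\<And>n. Q n (f n) (f (Suc n))" by blast
  define s V where "s = (\<lambda>n. fst (f n))" and "V = (\<lambda>n. snd (f n))"
  have zero: "0 \<in> V n" and large: "v \<in> V n \<Longrightarrow> real n < p (s n + v)" for n v
    using f(1)[of n] by (auto simp: P_def s_def V_def split: prod.splits)
  have small: "a \<in> V (Suc n) \<Longrightarrow> b \<in> V (Suc n) \<Longrightarrow> a - b \<in> U n" for n a b
    using f(2)[of n] by (auto simp: Q_def s_def V_def split: prod.splits)
  have step: "\<exists>W. open W \<and> 0 \<in> W \<and> (\<forall>v\<in>V (Suc n). \<forall>w\<in>W. s (Suc n) - s n + v - w \<in> V n)" for n
    using f(2)[of n] by (auto simp: Q_def s_def V_def split: prod.splits)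
  have step0: "s (Suc n) - s n + v \<in> V n" if "v \<in> V (Suc n)" for n v
    using step[of n] that by (metis diff_zero)
  have nested: "v \<in> V (n + k) \<Longrightarrow> s (n + k) - s n + v \<in> V n" for n k v
  proof (induction k arbitrary: v)
    case (Suc k)
    then have "s (n + Suc k) - s (n + k) + v \<in> V (n + k)"
      using step0 by simp
    from Suc.IH[OF this] show ?case by (simp add: algebra_simps)
  qed simp
  have tail: "s m - s n \<in> V n" if "n \<le> m" for m n
    using nested[of 0 n "m - n"] zero that by simp
  obtain l where l: "s \<longlonglongrightarrow> l"
  proof (rule complete_group_Cauchy_convergent[OF compl])
    fix A :: "'z set" assume "open A" "0 \<in> A"
    then obtain k where k: "U k \<subseteq> A" using base(3) by blast
    have "s m - s n \<in> A" if "m \<ge> Suc k" "n \<ge> Suc k" for m n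
    proof -
      have "(s m - s (Suc k)) - (s n - s (Suc k)) \<in> U k"
        using small tail that by blast
      then show ?thesis using k by auto
    qed
    then show "\<exists>N. \<forall>m\<ge>N. \<forall>n\<ge>N. s m - s n \<in> A" by blast
  qed
  have "real n < p l" for n
  proof -
    obtain W where W: "open W" "0 \<in> W"
      "\<And>v w. v \<in> V (Suc n) \<Longrightarrow> w \<in> W \<Longrightarrow> s (Suc n) - s n + v - w \<in> V n"
      using step[of n] by blast
    have "(\<lambda>m. s m - l) \<longlonglongrightarrow> l - l"
      by (intro tendsto_intros l)
    then have "\<forall>\<^sub>F m in sequentially. s m - l \<in> W"
      using W topological_tendstoD by force
    then obtain m where m: "m \<ge> Suc n" "s m - l \<in> W"
      unfolding eventually_sequentially by (meson nle_le)
    have "s (Suc n) - s n + (s m - s (Suc n)) - (s m - l) \<in> V n"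
      by (rule W(3)[OF tail[OF m(1)] m(2)])
    then have "l - s n \<in> V n" by simp
    from large[OF this] show ?thesis by simp
  qed
  then show False
    using reals_Archimedean2[of "p l"] by (meson less_asym)
qed

lemma metrizable_nhds_base:
  fixes a :: "'z::topological_space"
  assumes "metrizable_space (euclidean :: 'z topology)"
  obtains U :: "nat \<Rightarrow> 'z set" where "\<And>n. open (U n)" "\<And>n. a \<in> U n"
      "\<And>V. open V \<Longrightarrow> a \<in> V \<Longrightarrow> \<exists>n. U n \<subseteq> V"
proof -
  have "\<exists>B. countable B \<and> (\<forall>V\<in>B. open V) \<and> (\<forall>A. open A \<and> a \<in> A \<longrightarrow> (\<exists>V\<in>B. a \<in> V \<and> V \<subseteq> A))"
    using metrizable_imp_first_countable[OF assms] by (simp add: first_countable_def)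
  then obtain B where B: "countable B" "\<forall>V\<in>B. open V"
      "\<forall>A. open A \<and> a \<in> A \<longrightarrow> (\<exists>V\<in>B. a \<in> V \<and> V \<subseteq> A)"
    by (elim exE conjE)
  define B0 where "B0 = {V \<in> B. a \<in> V}"
  have B0: "countable B0" "B0 \<noteq> {}"
    using B(1) B(3)[THEN spec, of UNIV] by (auto simp: B0_def)
  show ?thesis
  proof
    fix n
    have "from_nat_into B0 n \<in> B0" using B0 from_nat_into by blast
    then show "open (from_nat_into B0 n)" "a \<in> from_nat_into B0 n"
      using B by (auto simp: B0_def)
  next
    fix V :: "'z set" assume "open V" "a \<in> V"
    then obtain A where "A \<in> B0" "A \<subseteq> V"
      using B(3) unfolding B0_def by blast
    then show "\<exists>n. from_nat_into B0 n \<subseteq> V"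
      using from_nat_into_surj[OF B0(1)] by metis
  qed
qed

lemma metrizable_closed_sequentially:
  fixes S :: "'z::topological_space set"
  assumes "metrizable_space (euclidean :: 'z topology)"
    and "\<And>s l. (\<And>n::nat. s n \<in> S) \<Longrightarrow> s \<longlonglongrightarrow> l \<Longrightarrow> l \<in> S"
  shows "closed S"
proof -
  obtain X :: "'z set" and d where X: "Metric_space X d" and eq: "euclidean = Metric_space.mtopology X d"
    using assms(1) unfolding metrizable_space_def by blast
  have "X = UNIV"
    using Metric_space.topspace_mtopology[OF X] eq by (metis topspace_euclidean)
  then have "closedin (euclidean :: 'z topology) S"
    unfolding eq Metric_space.metric_closedin_iff_sequentially_closed[OF X]
  proof (intro conjI allI impI)
    fix s l assume "range s \<subseteq> S \<and> limitin (Metric_space.mtopology X d) s l sequentially"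
    then show "l \<in> S"
      using assms(2)[of s l] unfolding eq[symmetric] by auto
  qed (use \<open>X = UNIV\<close> in simp)
  then show ?thesis by simp
qed

section \<open>Continuity of the Gelfand integral\<close>

lemma closed_sublevel_integral_norm:
  fixes \<phi> :: "'m \<Rightarrow> 'z::topological_space \<Rightarrow> 'f::{banach, second_countable_topology}"
  assumes metr: "metrizable_space (euclidean :: 'z topology)"
    and cont: "\<And>x. x \<in> space M \<Longrightarrow> continuous_on UNIV (\<phi> x)"
    and int: "\<And>z. integrable M (\<lambda>x. \<phi> x z)"
  shows "closed {z. (\<integral>x. norm (\<phi> x z) \<partial>M) \<le> c}"
proof (rule metrizable_closed_sequentially[OF metr])
  fix s l assume s: "\<And>n::nat. s n \<in> {z. (\<integral>x. norm (\<phi> x z) \<partial>M) \<le> c}" and l: "s \<longlonglongrightarrow> l"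
  have nn: "(\<integral>\<^sup>+x. ennreal (norm (\<phi> x z)) \<partial>M) = ennreal (\<integral>x. norm (\<phi> x z) \<partial>M)" for z
    by (rule nn_integral_eq_integral) (use int in auto)
  have c: "0 \<le> c"
  proof (rule order_trans)
    show "0 \<le> (\<integral>x. norm (\<phi> x (s 0)) \<partial>M)" by simp
    show "\<dots> \<le> c" using s[of 0] by simp
  qed
  have "(\<integral>\<^sup>+x. ennreal (norm (\<phi> x l)) \<partial>M) =
      (\<integral>\<^sup>+x. liminf (\<lambda>n. ennreal (norm (\<phi> x (s n)))) \<partial>M)"
  proof (rule nn_integral_cong)
    fix x assume "x \<in> space M"
    then have "(\<lambda>n. \<phi> x (s n)) \<longlonglongrightarrow> \<phi> x l"
      using continuous_on_tendsto_compose[OF cont l] by simp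
    then have "(\<lambda>n. ennreal (norm (\<phi> x (s n)))) \<longlonglongrightarrow> ennreal (norm (\<phi> x l))"
      by (intro tendsto_ennrealI tendsto_norm)
    then show "ennreal (norm (\<phi> x l)) = liminf (\<lambda>n. ennreal (norm (\<phi> x (s n))))"
      using lim_imp_Liminf[OF sequentially_bot] by metis
  qed
  also have "\<dots> \<le> liminf (\<lambda>n. \<integral>\<^sup>+x. ennreal (norm (\<phi> x (s n))) \<partial>M)"
    by (rule nn_integral_liminf) (use int in \<open>auto intro!: measurable_compose[OF _ measurable_ennreal]\<close>)
  also have "\<dots> \<le> ennreal c"
    unfolding nn using s by (intro Liminf_le always_eventually allI ennreal_leI) auto
  finally show "l \<in> {z. (\<integral>x. norm (\<phi> x z) \<partial>M) \<le> c}"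
    using c by (simp add: nn)
qed

lemma (in frechet_space) bounded_near_zero_imp_top_dual:
  assumes lin: "Vector_Spaces.linear smul (*) T"
    and V: "open V" "0 \<in> V" and bound: "\<And>v. v \<in> V \<Longrightarrow> norm (T v) \<le> C"
  shows "T \<in> top_dual smul"
proof -
  interpret T: Vector_Spaces.linear smul "(*)" T by (rule lin)
  have "(T \<longlongrightarrow> T z) (at z)" for z
  proof (rule tendstoI)
    fix e :: real assume e: "0 < e"
    \<comment> \<open>If \<open>r \<cdot> (y - z) \<in> V\<close>, then \<open>r |T y - T z| \<le> C < r e\<close>.\<close>
    define r where "r = (\<bar>C\<bar> + 1) / e"
    have r: "0 < r" "C < r * e" using e by (auto simp: r_def)
    define A where "A = (\<lambda>y. smul (of_real r) (y - z)) -` V"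
    have "continuous_on UNIV ((\<lambda>(a, x). smul a x) \<circ> (\<lambda>y. (of_real r, y - z)))"
      by (intro continuous_on_compose continuous_on_subset[OF continuous_scale] continuous_intros) auto
    then have "open A"
      unfolding A_def by (intro open_vimage V) (simp add: o_def)
    moreover have "z \<in> A"
      using V by (simp add: A_def)
    ultimately have "\<forall>\<^sub>F y in at z. y \<in> A"
      by (rule eventually_at_in_open')
    then show "\<forall>\<^sub>F y in at z. dist (T y) (T z) < e"
    proof (rule eventually_mono)
      fix y assume "y \<in> A"
      then have "norm (T (smul (of_real r) (y - z))) \<le> C"
        using bound by (simp add: A_def)
      then have "r * norm (T y - T z) \<le> C"
        using r(1) by (simp add: T.scale T.diff norm_mult)
      then have "r * norm (T y - T z) < r * e" using r(2) by linarith
      then show "dist (T y) (T z) < e"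
        using r(1) by (simp add: dist_norm)
    qed
  qed
  then have "continuous_on UNIV T"
    by (simp add: continuous_on_def)
  then show ?thesis using lin by (simp add: top_dual_def)
qed

lemma (in frechet_space) gelfand_integral_in_top_dual:
  assumes \<phi>: "gelfand_integrable smul M \<phi>" and E: "E \<in> sets M"
  shows "gelfand_integral M E \<phi> \<in> top_dual smul"
proof -
  have int: "integrable M (\<lambda>x. \<phi> x z)" for z
    using \<phi> by (simp add: gelfand_integrable_def)
  have intE: "set_integrable M E (\<lambda>x. \<phi> x z)" for z
    unfolding set_integrable_def by (rule integrable_mult_indicator[OF E int])
  have dual: "\<phi> x \<in> top_dual smul" if "x \<in> space M" for x
    using \<phi> that by (auto simp: gelfand_integrable_def)
  have lin: "Vector_Spaces.linear smul (*) (\<phi> x)" if "x \<in> space M" for x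
    using dual[OF that] by (simp add: top_dual_def)
  have add: "\<phi> x (y + z) = \<phi> x y + \<phi> x z" and scale: "\<phi> x (smul a z) = a * \<phi> x z"
    if "x \<in> space M" for x y z a
    using lin[OF that] by (simp_all add: Vector_Spaces.linear_iff)
  define p where "p z = (\<integral>x. norm (\<phi> x z) \<partial>M)" for z
  obtain U :: "nat \<Rightarrow> 'z set" where U: "\<And>n. open (U n)" "\<And>n. 0 \<in> U n"
      "\<And>V. open V \<Longrightarrow> 0 \<in> V \<Longrightarrow> \<exists>n. U n \<subseteq> V"
    using metrizable_nhds_base[OF metrizable, of 0] by metis
  have "\<exists>V C. open V \<and> 0 \<in> V \<and> (\<forall>v\<in>V. p v \<le> C)"
  proof (rule subadditive_closed_sublevel_bounded[OF complete_UNIV U])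
    fix y z
    have "p (y + z) \<le> (\<integral>x. norm (\<phi> x y) + norm (\<phi> x z) \<partial>M)"
      unfolding p_def
      by (intro integral_mono Bochner_Integration.integrable_add integrable_norm int)
        (simp add: add norm_triangle_ineq)
    also have "\<dots> = p y + p z"
      unfolding p_def by (intro Bochner_Integration.integral_add integrable_norm int)
    finally show "p (y + z) \<le> p y + p z" .
  next
    fix c show "closed {z. p z \<le> c}"
      unfolding p_def
      using closed_sublevel_integral_norm[OF metrizable _ int] dual by (simp add: top_dual_def)
  qed
  then obtain V C where V: "open V" "0 \<in> V" and C: "\<And>v. v \<in> V \<Longrightarrow> p v \<le> C"
    by blast
  have "Vector_Spaces.linear smul (*) (gelfand_integral M E \<phi>)"
    unfolding Vector_Spaces.linear_iff
  proof (intro conjI allI)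
    show "vector_space smul" "vector_space ((*) :: 'f \<Rightarrow> 'f \<Rightarrow> 'f)"
      by unfold_locales (simp_all add: algebra_simps)
    show "gelfand_integral M E \<phi> (y + z) = gelfand_integral M E \<phi> y + gelfand_integral M E \<phi> z" for y z
    proof -
      have "gelfand_integral M E \<phi> (y + z) = (LINT x:E|M. \<phi> x y + \<phi> x z)"
        unfolding gelfand_integral_def using E sets.sets_into_space[OF E]
        by (intro set_lebesgue_integral_cong) (auto simp: add subset_iff)
      then show ?thesis
        using set_integral_add(2)[OF intE intE] by (simp add: gelfand_integral_def)
    qed
    show "gelfand_integral M E \<phi> (smul a z) = a * gelfand_integral M E \<phi> z" for a z
    proof -
      have "gelfand_integral M E \<phi> (smul a z) = (LINT x:E|M. a * \<phi> x z)"
        unfolding gelfand_integral_def using E sets.sets_into_space[OF E]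
        by (intro set_lebesgue_integral_cong) (auto simp: scale subset_iff)
      then show ?thesis
        by (simp add: gelfand_integral_def)
    qed
  qed
  moreover have "norm (gelfand_integral M E \<phi> v) \<le> C" if "v \<in> V" for v
  proof -
    have "norm (gelfand_integral M E \<phi> v) \<le> p v"
      unfolding gelfand_integral_def set_lebesgue_integral_def p_def
      by (rule order_trans[OF integral_norm_bound], intro integral_mono integrable_norm
          integrable_mult_indicator E int) (auto simp: indicator_def)
    then show ?thesis using C[OF that] by simp
  qed
  ultimately show ?thesis
    by (intro bounded_near_zero_imp_top_dual[OF _ V])
qed

section \<open>Dominated convergence\<close>

theorem theorem3p11:
  fixes M :: "'m measure"
    and smul :: "'f::real_or_complex \<Rightarrow> 'z::{uniform_topological_group_add, ab_group_add} \<Rightarrow> 'z"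
    and \<psi>k :: "nat \<Rightarrow> 'm \<Rightarrow> 'z \<Rightarrow> 'f"
    and \<psi> :: "'m \<Rightarrow> 'z \<Rightarrow> 'f"
  assumes "sigma_finite_measure M"
    and "frechet_space smul"
    and "\<And>k. \<psi>k k \<in> space M \<rightarrow> top_dual smul"
    and "\<psi> \<in> space M \<rightarrow> top_dual smul"
    and "\<And>z k. (\<lambda>x. \<psi>k k x z) \<in> borel_measurable M"
    and "\<And>z. (\<lambda>x. \<psi> x z) \<in> borel_measurable M"
    and "AE x in M. limitin (weak_star smul) (\<lambda>k. \<psi>k k x) (\<psi> x) sequentially"
    and "\<And>z. \<exists>g :: 'm \<Rightarrow> real. \<exists>N \<in> null_sets M.
           integrable M g \<and> (\<forall>x\<in>space M. 0 \<le> g x) \<and>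
           (\<forall>x\<in>space M - N. \<forall>k. norm (\<psi>k k x z) \<le> g x)"
  shows "(\<forall>k. gelfand_integrable smul M (\<psi>k k)) \<and>
    gelfand_integrable smul M \<psi> \<and>
    limitin (weak_star smul)
      (\<lambda>k. gelfand_integral M (space M) (\<psi>k k))
      (gelfand_integral M (space M) \<psi>) sequentially"
proof -
  interpret frechet_space smul by fact
  have dual: "\<psi>k k x \<in> top_dual smul" if "x \<in> space M" for k x
    using assms(3) that by blast
  have lim: "AE x in M. (\<lambda>k. \<psi>k k x z) \<longlonglongrightarrow> \<psi> x z" for z
    using assms(7) AE_space
  proof eventually_elim
    fix x assume "x \<in> space M" and "limitin (weak_star smul) (\<lambda>k. \<psi>k k x) (\<psi> x) sequentially"
    then show "(\<lambda>k. \<psi>k k x z) \<longlonglongrightarrow> \<psi> x z"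
      using limitin_weak_star_iff[of "\<lambda>k. \<psi>k k x"] dual by blast
  qed
  have "(\<forall>k. integrable M (\<lambda>x. \<psi>k k x z)) \<and> integrable M (\<lambda>x. \<psi> x z) \<and>
    (\<lambda>k. \<integral>x. \<psi>k k x z \<partial>M) \<longlonglongrightarrow> (\<integral>x. \<psi> x z \<partial>M)" for z
  proof -
    obtain g :: "'m \<Rightarrow> real" and N where N: "N \<in> null_sets M" and g: "integrable M g"
      and le: "\<forall>x\<in>space M - N. \<forall>k. norm (\<psi>k k x z) \<le> g x"
      using assms(8)[of z] by blast
    have bound: "AE x in M. norm (\<psi>k k x z) \<le> g x" for k
      using AE_not_in[OF N] AE_space by eventually_elim (use le in blast)
    note dom = assms(6)[of z] assms(5)[of _ z] g lim bound
    show ?thesis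
      using integrable_dominated_convergence[OF dom] integrable_dominated_convergence2[OF dom]
        integral_dominated_convergence[OF dom] by blast
  qed
  then have gk: "gelfand_integrable smul M (\<psi>k k)" and g: "gelfand_integrable smul M \<psi>"
    and conv: "(\<lambda>k. \<integral>x. \<psi>k k x z \<partial>M) \<longlonglongrightarrow> (\<integral>x. \<psi> x z \<partial>M)" for k z
    using assms(3,4) by (auto simp: gelfand_integrable_def)
  have space: "gelfand_integral M (space M) \<phi> z = (\<integral>x. \<phi> x z \<partial>M)"
    if "gelfand_integrable smul M \<phi>" for \<phi> z
    using that by (simp add: gelfand_integral_def gelfand_integrable_def set_integral_space)
  have "limitin (weak_star smul) (\<lambda>k. gelfand_integral M (space M) (\<psi>k k))
      (gelfand_integral M (space M) \<psi>) sequentially"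
    using gelfand_integral_in_top_dual[OF gk] gelfand_integral_in_top_dual[OF g] conv
    by (subst limitin_weak_star_iff) (auto simp: space gk g)
  then show ?thesis using gk g by blast
qed

end
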